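(* Let $R$ be a commutative ring with $1\neq 0$ and let $S$ be a multiplicatively closed subset of $R$. Every irreducible closed subset of $\mathrm{Spec}_SR$ with respect to the $S$-flat topology has a generic point.
   Context: A multiplicatively closed subset $S$ of $R$ satisfies $0\notin S$, $1\in S$, and $ss'\in S$ for all $s,s'\in S$. An ideal $P$ of $R$ is $S$-prime if $P\cap S=\emptyset$ and there exists $s\in S$ such that for all $a,b\in R$, $ab\in P$ implies $sa\in P$ or $sb\in P$. $\mathrm{Spec}_SR$ is the set of all $S$-prime ideals of $R$. For $f\in R$, $V_S(f)=\{P\in\mathrm{Spec}_SR : sf\in P \text{ for some } s\in S\}$. The $S$-flat topology on $\mathrm{Spec}_SR$ is the topology having the sets $V_S(f)$, $f\in R$, as a sub-basis of open sets. A generic point of a closed subset $F$ is a point $P\in F$ whose closure is $F$. It is not claimed to be unique. Irreducible sets are nonempty by convention. *)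

theory Defs
  imports "HOL-Algebra.Ideal" "HOL-Analysis.Function_Topology"
begin

definition mult_closed_subset :: "('a, 'b) ring_scheme \<Rightarrow> 'a set \<Rightarrow> bool" where
  "mult_closed_subset R S \<longleftrightarrow>
     S \<subseteq> carrier R \<and> \<zero>\<^bsub>R\<^esub> \<notin> S \<and> \<one>\<^bsub>R\<^esub> \<in> S \<and> (\<forall>s\<in>S. \<forall>s'\<in>S. s \<otimes>\<^bsub>R\<^esub> s' \<in> S)"

definition S_prime :: "('a, 'b) ring_scheme \<Rightarrow> 'a set \<Rightarrow> 'a set \<Rightarrow> bool" where
  "S_prime R S P \<longleftrightarrow>
     ideal P R \<and> P \<inter> S = {} \<and>
     (\<exists>s\<in>S. \<forall>a\<in>carrier R. \<forall>b\<in>carrier R.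
        a \<otimes>\<^bsub>R\<^esub> b \<in> P \<longrightarrow> s \<otimes>\<^bsub>R\<^esub> a \<in> P \<or> s \<otimes>\<^bsub>R\<^esub> b \<in> P)"

definition S_Spec :: "('a, 'b) ring_scheme \<Rightarrow> 'a set \<Rightarrow> 'a set set" where
  "S_Spec R S = {P. S_prime R S P}"

definition V_S :: "('a, 'b) ring_scheme \<Rightarrow> 'a set \<Rightarrow> 'a \<Rightarrow> 'a set set" where
  "V_S R S f = {P \<in> S_Spec R S. \<exists>s\<in>S. s \<otimes>\<^bsub>R\<^esub> f \<in> P}"

definition S_flat_topology :: "('a, 'b) ring_scheme \<Rightarrow> 'a set \<Rightarrow> 'a set topology" where
  "S_flat_topology R S = topology_generated_by {V_S R S f | f. f \<in> carrier R}"

text \<open>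
  The underlying set of \<^const>\<open>topology_generated_by\<close> is the union of the generating sets;
  here it is the whole \<open>S\<close>-spectrum, because \<open>V_S R S \<zero>\<close> is.
\<close>

lemma topspace_S_flat_topology:
  assumes "cring R" "mult_closed_subset R S"
  shows "topspace (S_flat_topology R S) = S_Spec R S"
proof -
  interpret cring R by fact
  have "P \<in> V_S R S \<zero>\<^bsub>R\<^esub>" if "P \<in> S_Spec R S" for P
  proof -
    have "ideal P R" using that by (simp add: S_Spec_def S_prime_def)
    then have "\<zero>\<^bsub>R\<^esub> \<in> P" by (simp add: additive_subgroup.zero_closed ideal_def)
    moreover have "\<one>\<^bsub>R\<^esub> \<in> S" using assms(2) by (simp add: mult_closed_subset_def)
    ultimately have "\<exists>s\<in>S. s \<otimes>\<^bsub>R\<^esub> \<zero>\<^bsub>R\<^esub> \<in> P" by (intro bexI[of _ "\<one>\<^bsub>R\<^esub>"]) simp_all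
    then show ?thesis using that by (simp add: V_S_def)
  qed
  then show ?thesis
    unfolding S_flat_topology_def topology_generated_by_topspace
    by (auto simp: V_S_def)
qed

definition irreducible_in :: "'p topology \<Rightarrow> 'p set \<Rightarrow> bool" where
  "irreducible_in X F \<longleftrightarrow>
     F \<subseteq> topspace X \<and> F \<noteq> {} \<and>
     (\<forall>A B. closedin (subtopology X F) A \<and> closedin (subtopology X F) B \<and> F = A \<union> B
        \<longrightarrow> A = F \<or> B = F)"

definition generic_point :: "'p topology \<Rightarrow> 'p set \<Rightarrow> 'p \<Rightarrow> bool" where
  "generic_point X F P \<longleftrightarrow> P \<in> F \<and> X closure_of {P} = F"

end

theory Submission
  imports Defs
begin

text \<open>
  For an \<open>S\<close>-prime ideal \<open>P\<close>, the saturation \<open>P\<^sup>* = {f. s f \<in> P for some s \<in> S}\<close> is a genuine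
  prime ideal disjoint from \<open>S\<close>, and \<open>P \<in> V_S f\<close> says exactly that \<open>f \<in> P\<^sup>*\<close>. The topology therefore
  sees \<open>P\<close> only through \<open>P\<^sup>*\<close>.

  Given an irreducible closed set \<open>F\<close>, a generic point must lie in precisely those sub-basic open
  sets that meet \<open>F\<close>. In terms of saturations this means that its saturation is the union \<open>Q\<close> of all
  \<open>P\<^sup>*\<close> with \<open>P \<in> F\<close>, so \<open>Q\<close> is the candidate. Two nonempty open subsets of the irreducible \<open>F\<close>
  always intersect; applied to \<open>V_S f \<inter> F\<close> and \<open>V_S g \<inter> F\<close>, this says that any two
  elements of \<open>Q\<close> lie in a common \<open>P\<^sup>*\<close>. Hence \<open>Q\<close> is closed under addition, and the other properties
  of a prime ideal disjoint from \<open>S\<close> pass to unions. Such a \<open>Q\<close> is \<open>S\<close>-prime and equal to its own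
  saturation, so it is a point of the spectrum lying in the right sub-basic sets.

  Irreducibility is used once more to pass from sub-basic to arbitrary open sets
  (\<open>generic_point_if_subbasis\<close>); this gives \<open>{Q}\<close> the same closure as \<open>F\<close>, namely \<open>F\<close> itself.
\<close>

lemma irreducible_in_openin_Int:
  assumes irr: "irreducible_in X F" and U: "openin X U" and W: "openin X W"
    and UF: "U \<inter> F \<noteq> {}" and WF: "W \<inter> F \<noteq> {}"
  shows "U \<inter> W \<inter> F \<noteq> {}"
proof
  assume "U \<inter> W \<inter> F = {}"
  then have cover: "F = (F - U) \<union> (F - W)" by blast
  have closed: "closedin (subtopology X F) (F - V)" if "openin X V" for V
  proof -
    have "F - V = (topspace X - V) \<inter> F"
      using irr by (auto simp: irreducible_in_def)
    then show ?thesis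
      using that by (auto simp: closedin_subtopology)
  qed
  have "F - U = F \<or> F - W = F"
    using irr closed[OF U] closed[OF W] cover unfolding irreducible_in_def by blast
  then show False using UF WF by blast
qed

text \<open>
  Genericity can be tested on a sub-basis: the open sets that contain \<open>P\<close> exactly when they meet \<open>F\<close>
  are stable under unions, and, because \<open>F\<close> is irreducible, under binary intersections.
\<close>

lemma generic_point_if_subbasis:
  assumes closed: "closedin (topology_generated_by \<B>) F"
    and irr: "irreducible_in (topology_generated_by \<B>) F"
    and P: "P \<in> \<Union>\<B>"
    and subbasis: "\<And>V. V \<in> \<B> \<Longrightarrow> P \<in> V \<longleftrightarrow> V \<inter> F \<noteq> {}"
  shows "generic_point (topology_generated_by \<B>) F P"
proof -
  let ?X = "topology_generated_by \<B>"
  have iff: "P \<in> U \<longleftrightarrow> U \<inter> F \<noteq> {}" if "generate_topology_on \<B> U" for U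
    using that
  proof induction
    case (Int U W)
    then show ?case
      using irreducible_in_openin_Int[OF irr, of U W]
      by (auto simp: openin_topology_generated_by_iff)
  qed (use subbasis in auto)
  have "?X closure_of {P} = ?X closure_of F"
    using iff by (auto simp: closure_of_def openin_topology_generated_by_iff)
  then have eq: "?X closure_of {P} = F"
    using closure_of_closedin[OF closed] by simp
  have "P \<in> topspace ?X" using P by (simp add: topology_generated_by_topspace)
  then have "P \<in> ?X closure_of {P}"
    using closure_of_subset[of "{P}" ?X] by simp
  with eq show ?thesis by (simp add: generic_point_def)
qed

text \<open>
  Sums are the only place where two elements from different members of the family have to be
  brought into a common one; all other conditions concern one element of the union at a time.
\<close>

lemma (in cring) Union_directed_primeideals:
  assumes ne: "\<C> \<noteq> {}" and prime: "\<And>I. I \<in> \<C> \<Longrightarrow> primeideal I R"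
    and directed: "\<And>a b. \<lbrakk>a \<in> \<Union>\<C>; b \<in> \<Union>\<C>\<rbrakk> \<Longrightarrow> \<exists>I\<in>\<C>. a \<in> I \<and> b \<in> I"
  shows "primeideal (\<Union>\<C>) R"
proof (rule primeidealI)
  have idl: "ideal I R" if "I \<in> \<C>" for I using prime[OF that] by (rule primeideal.axioms)
  show "ideal (\<Union>\<C>) R"
  proof (rule idealI)
    show "ring R" by (rule ring_axioms)
    show "subgroup (\<Union>\<C>) (add_monoid R)"
    proof (rule add.subgroupI)
      show "\<Union>\<C> \<subseteq> carrier R" using ideal.Icarr[OF idl] by blast
      show "\<Union>\<C> \<noteq> {}"
        using ne additive_subgroup.zero_closed[OF ideal.axioms(1)[OF idl]] by blast
      show "\<ominus> a \<in> \<Union>\<C>" if "a \<in> \<Union>\<C>" for a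
        using that additive_subgroup.a_inv_closed[OF ideal.axioms(1)[OF idl]] by blast
      show "a \<oplus> b \<in> \<Union>\<C>" if "a \<in> \<Union>\<C>" "b \<in> \<Union>\<C>" for a b
        using directed[OF that] additive_subgroup.a_closed[OF ideal.axioms(1)[OF idl]] by blast
    qed
    show "x \<otimes> a \<in> \<Union>\<C>" if "a \<in> \<Union>\<C>" "x \<in> carrier R" for a x
      using that ideal.I_l_closed[OF idl] by blast
    show "a \<otimes> x \<in> \<Union>\<C>" if "a \<in> \<Union>\<C>" "x \<in> carrier R" for a x
      using that ideal.I_r_closed[OF idl] by blast
  qed
  show "cring R" by (rule cring_axioms)
  show "carrier R \<noteq> \<Union>\<C>"
  proof
    assume "carrier R = \<Union>\<C>"
    then obtain I where I: "I \<in> \<C>" "\<one> \<in> I" using one_closed by blast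
    then show False
      using ideal.one_imp_carrier[OF idl] primeideal.I_notcarr[OF prime] by blast
  qed
  show "a \<in> \<Union>\<C> \<or> b \<in> \<Union>\<C>" if "a \<in> carrier R" "b \<in> carrier R" "a \<otimes> b \<in> \<Union>\<C>" for a b
    using that primeideal.I_prime[OF prime] by blast
qed

definition saturation :: "('a, 'b) ring_scheme \<Rightarrow> 'a set \<Rightarrow> 'a set \<Rightarrow> 'a set" where
  "saturation R S P = {f \<in> carrier R. \<exists>s\<in>S. s \<otimes>\<^bsub>R\<^esub> f \<in> P}"

lemma V_S_iff_saturation:
  "f \<in> carrier R \<Longrightarrow> P \<in> V_S R S f \<longleftrightarrow> P \<in> S_Spec R S \<and> f \<in> saturation R S P"
  by (simp add: V_S_def saturation_def)

lemma saturation_disjoint: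
  assumes "mult_closed_subset R S" and "P \<inter> S = {}"
  shows "saturation R S P \<inter> S = {}"
  using assms by (auto simp: saturation_def mult_closed_subset_def)

text \<open>
  Multiplying by the distinguished element \<open>s\<close> of an \<open>S\<close>-prime ideal costs nothing after saturating,
  so the defining condition turns into ordinary primality.
\<close>

lemma (in cring) primeideal_saturation:
  assumes S: "mult_closed_subset R S" and P: "S_prime R S P"
  shows "primeideal (saturation R S P) R"
proof -
  have SR: "\<And>s. s \<in> S \<Longrightarrow> s \<in> carrier R" and S1: "\<one> \<in> S"
    and Smult: "\<And>s t. \<lbrakk>s \<in> S; t \<in> S\<rbrakk> \<Longrightarrow> s \<otimes> t \<in> S"
    using S by (auto simp: mult_closed_subset_def)
  interpret P: ideal P R using P by (simp add: S_prime_def)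
  have disj: "P \<inter> S = {}" using P by (simp add: S_prime_def)
  have mult: "x \<otimes> a \<in> saturation R S P" if a: "a \<in> saturation R S P" and x: "x \<in> carrier R" for a x
  proof -
    obtain s where s: "s \<in> S" "s \<otimes> a \<in> P" and aR: "a \<in> carrier R"
      using a by (auto simp: saturation_def)
    have "s \<otimes> (x \<otimes> a) = x \<otimes> (s \<otimes> a)" using SR[OF s(1)] aR x by (simp add: m_lcomm)
    also have "\<dots> \<in> P" using s(2) x by (rule P.I_l_closed)
    finally show ?thesis using s(1) x aR by (auto simp: saturation_def)
  qed
  show ?thesis
  proof (rule primeidealI)
    show "ideal (saturation R S P) R"
    proof (rule idealI)
      show "ring R" by (rule ring_axioms)
      show "subgroup (saturation R S P) (add_monoid R)"
      proof (rule add.subgroupI)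
        show "saturation R S P \<subseteq> carrier R" by (auto simp: saturation_def)
        show "saturation R S P \<noteq> {}"
          using S1 P.zero_closed by (force simp: saturation_def)
        show "\<ominus> a \<in> saturation R S P" if "a \<in> saturation R S P" for a
        proof -
          have "\<ominus> a = (\<ominus> \<one>) \<otimes> a" using that by (simp add: saturation_def l_minus)
          then show ?thesis using mult[OF that] by simp
        qed
        show "a \<oplus> b \<in> saturation R S P"
          if a: "a \<in> saturation R S P" and b: "b \<in> saturation R S P" for a b
        proof -
          obtain s t where s: "s \<in> S" "s \<otimes> a \<in> P" and t: "t \<in> S" "t \<otimes> b \<in> P"
            and R: "a \<in> carrier R" "b \<in> carrier R"
            using a b by (auto simp: saturation_def)
          have "(s \<otimes> t) \<otimes> (a \<oplus> b) = t \<otimes> (s \<otimes> a) \<oplus> s \<otimes> (t \<otimes> b)"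
            using SR[OF s(1)] SR[OF t(1)] R by (simp add: r_distr m_ac)
          also have "\<dots> \<in> P"
            using s t SR by (simp add: P.I_l_closed P.a_closed)
          finally show ?thesis using Smult[OF s(1) t(1)] R by (auto simp: saturation_def)
        qed
      qed
      show "x \<otimes> a \<in> saturation R S P" if "a \<in> saturation R S P" "x \<in> carrier R" for a x
        using mult[OF that] .
      show "a \<otimes> x \<in> saturation R S P" if "a \<in> saturation R S P" "x \<in> carrier R" for a x
        using mult[OF that] that m_comm[of x a] by (simp add: saturation_def)
    qed
    show "cring R" by (rule cring_axioms)
    show "carrier R \<noteq> saturation R S P"
      using saturation_disjoint[OF S disj] S1 by auto
    show "a \<in> saturation R S P \<or> b \<in> saturation R S P"
      if R: "a \<in> carrier R" "b \<in> carrier R" and ab: "a \<otimes> b \<in> saturation R S P" for a b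
    proof -
      obtain s where s: "s \<in> S"
        and s_prime: "\<And>a b. \<lbrakk>a \<in> carrier R; b \<in> carrier R; a \<otimes> b \<in> P\<rbrakk> \<Longrightarrow> s \<otimes> a \<in> P \<or> s \<otimes> b \<in> P"
        using P by (auto simp: S_prime_def)
      obtain t where t: "t \<in> S" "t \<otimes> (a \<otimes> b) \<in> P" using ab by (auto simp: saturation_def)
      then have "(t \<otimes> a) \<otimes> b \<in> P" using SR R by (simp add: m_assoc)
      then have "s \<otimes> (t \<otimes> a) \<in> P \<or> s \<otimes> b \<in> P" using s_prime SR[OF t(1)] R by simp
      then have "(s \<otimes> t) \<otimes> a \<in> P \<or> s \<otimes> b \<in> P" using SR s t R by (simp add: m_assoc)
      then show ?thesis using R s Smult[OF s t(1)] by (auto simp: saturation_def)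
    qed
  qed
qed

lemma (in cring) S_prime_primeideal:
  assumes S: "mult_closed_subset R S" and P: "primeideal P R" and disj: "P \<inter> S = {}"
  shows "S_prime R S P"
proof -
  interpret P: primeideal P R by fact
  have "\<one> \<otimes> a \<in> P \<or> \<one> \<otimes> b \<in> P" if "a \<in> carrier R" "b \<in> carrier R" "a \<otimes> b \<in> P" for a b
    using P.I_prime[OF that] that by simp
  then show ?thesis
    using S disj P.ideal_axioms unfolding S_prime_def mult_closed_subset_def by blast
qed

lemma (in cring) saturation_primeideal:
  assumes S: "mult_closed_subset R S" and P: "primeideal P R" and disj: "P \<inter> S = {}"
  shows "saturation R S P = P"
proof -
  interpret P: primeideal P R by fact
  have "f \<in> P" if "f \<in> saturation R S P" for f
    using that S disj P.I_prime by (auto simp: saturation_def mult_closed_subset_def)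
  moreover have "f \<in> saturation R S P" if "f \<in> P" for f
    using that S P.Icarr by (auto simp: saturation_def mult_closed_subset_def intro!: bexI[of _ \<one>])
  ultimately show ?thesis by blast
qed

theorem theorem4p5:
  fixes R :: "('a, 'b) ring_scheme" and S :: "'a set" and F :: "'a set set"
  assumes "cring R" and "\<one>\<^bsub>R\<^esub> \<noteq> \<zero>\<^bsub>R\<^esub>"
    and "mult_closed_subset R S"
    and "closedin (S_flat_topology R S) F"
    and "irreducible_in (S_flat_topology R S) F"
  shows "\<exists>P. generic_point (S_flat_topology R S) F P"
proof -
  interpret cring R by fact
  note S = assms(3) and closed = assms(4) and irr = assms(5)
  define Q where "Q = \<Union>(saturation R S ` F)"
  have F_spec: "P \<in> S_Spec R S" if "P \<in> F" for P
    using that irr topspace_S_flat_topology[OF assms(1) S] by (auto simp: irreducible_in_def)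
  have QR: "f \<in> carrier R" if "f \<in> Q" for f
    using that by (auto simp: Q_def saturation_def)
  have meets: "V_S R S f \<inter> F \<noteq> {} \<longleftrightarrow> f \<in> Q" if "f \<in> carrier R" for f
    using F_spec by (auto simp: Q_def V_S_iff_saturation[OF that] disjoint_iff)
  have open_V: "openin (S_flat_topology R S) (V_S R S f)" if "f \<in> carrier R" for f
    using that unfolding S_flat_topology_def by (auto intro!: topology_generated_by_Basis)
  have "primeideal Q R"
    unfolding Q_def
  proof (rule Union_directed_primeideals)
    show "saturation R S ` F \<noteq> {}" using irr by (simp add: irreducible_in_def)
    show "primeideal I R" if "I \<in> saturation R S ` F" for I
      using that F_spec primeideal_saturation[OF S] by (auto simp: S_Spec_def)
    fix a b
    assume "a \<in> \<Union>(saturation R S ` F)" "b \<in> \<Union>(saturation R S ` F)"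
    then have ab: "a \<in> Q" "b \<in> Q" by (simp_all add: Q_def)
    note aR = QR[OF ab(1)] and bR = QR[OF ab(2)]
    have "V_S R S a \<inter> V_S R S b \<inter> F \<noteq> {}"
      by (rule irreducible_in_openin_Int[OF irr open_V[OF aR] open_V[OF bR]])
        (use ab meets[OF aR] meets[OF bR] in simp_all)
    then show "\<exists>I\<in>saturation R S ` F. a \<in> I \<and> b \<in> I"
      by (auto simp: V_S_iff_saturation[OF aR] V_S_iff_saturation[OF bR])
  qed
  moreover have "Q \<inter> S = {}"
  proof -
    have "saturation R S P \<inter> S = {}" if "P \<in> F" for P
      using F_spec[OF that] saturation_disjoint[OF S] by (simp add: S_Spec_def S_prime_def)
    then show ?thesis by (auto simp: Q_def)
  qed
  ultimately have Q_spec: "Q \<in> S_Spec R S" and Q_sat: "saturation R S Q = Q"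
    using S_prime_primeideal[OF S] saturation_primeideal[OF S] by (simp_all add: S_Spec_def)
  have "generic_point (S_flat_topology R S) F Q"
    unfolding S_flat_topology_def
  proof (rule generic_point_if_subbasis)
    show "Q \<in> V \<longleftrightarrow> V \<inter> F \<noteq> {}" if V: "V \<in> {V_S R S f |f. f \<in> carrier R}" for V
    proof -
      from V obtain f where f: "f \<in> carrier R" "V = V_S R S f" by (elim CollectE exE conjE)
      have "Q \<in> V_S R S f \<longleftrightarrow> f \<in> Q"
        by (simp add: V_S_iff_saturation[OF f(1)] Q_spec Q_sat)
      then show ?thesis
        unfolding f(2) by (rule trans[OF _ meets[OF f(1), symmetric]])
    qed
    show "Q \<in> \<Union> {V_S R S f |f. f \<in> carrier R}"
      using Q_spec topspace_S_flat_topology[OF assms(1) S]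
      by (simp add: S_flat_topology_def)
  qed (use closed irr in \<open>simp_all add: S_flat_topology_def\<close>)
  then show ?thesis ..
qed

end
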